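(* Let $R$ be a commutative semiring and let $S\subseteq \operatorname{Reg}(R)$ be a multiplicatively closed subset. Let $I$ be a proper ideal of $R$ with $I\cap S=\emptyset$. Then $I$ is a quasi $S$-$n$-ideal of $R$ if and only if $I$ is a strongly quasi $S$-primary ideal of $R$ and $\sqrt{I}=N(R)$.
   Context: All semirings are commutative with identity $1\neq 0$. A subset $S$ of $R$ is multiplicatively closed if $0\notin S$, $1\in S$, and $st\in S$ for all $s,t\in S$. $\operatorname{Reg}(R)$ is the set of regular elements of $R$, i.e. elements that are not zero-divisors. For an ideal $I$, $\sqrt{I}=\{a\in R: a^n\in I \text{ for some } n\in\mathbb{N}\}$, and $N(R)=\sqrt{(0)}$ is the nilradical. A proper ideal $I$ of $R$ with $I\cap S=\emptyset$ is a quasi $S$-$n$-ideal of $R$ if there exists a fixed element $s\in S$ such that, for all $a,b\in R$, $ab\in I$ implies $sa^2\in I$ or $sb\in N(R)$. A proper ideal $I$ of $R$ with $I\cap S=\emptyset$ is a strongly quasi $S$-primary ideal if there exists $s\in S$ such that, for all $a,b\in R$, $ab\in I$ implies $sa^2\in I$ or $sb\in\sqrt{I}$. *)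

theory Defs
  imports Main
begin

text \<open>
  Commutative semirings with \<open>1 \<noteq> 0\<close> are modelled by the type class \<^class>\<open>comm_semiring_1\<close>,
  whose axioms include that \<open>0\<close> is absorbing and \<open>0 \<noteq> 1\<close>. The library has ideals
  only over rings, hence the notions below.
\<close>

definition semiring_ideal :: "'a::comm_semiring_1 set \<Rightarrow> bool" where
  "semiring_ideal I \<longleftrightarrow>
     I \<noteq> {} \<and> (\<forall>a\<in>I. \<forall>b\<in>I. a + b \<in> I) \<and> (\<forall>r. \<forall>a\<in>I. r * a \<in> I)"

definition proper_ideal :: "'a::comm_semiring_1 set \<Rightarrow> bool" where
  "proper_ideal I \<longleftrightarrow> semiring_ideal I \<and> I \<noteq> UNIV"

definition mult_closed :: "'a::comm_semiring_1 set \<Rightarrow> bool" where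
  "mult_closed S \<longleftrightarrow> 0 \<notin> S \<and> 1 \<in> S \<and> (\<forall>s\<in>S. \<forall>t\<in>S. s * t \<in> S)"

text \<open>Under this definition \<open>0\<close> is itself a zero-divisor.\<close>

definition zero_divisor :: "'a::comm_semiring_1 \<Rightarrow> bool" where
  "zero_divisor a \<longleftrightarrow> (\<exists>b. b \<noteq> 0 \<and> a * b = 0)"

definition Reg :: "'a::comm_semiring_1 set" where
  "Reg = {a. \<not> zero_divisor a}"

text \<open>
  Exponents are positive. Allowing \<open>n = 0\<close> would not change the radical of an ideal: \<open>1 \<in> I\<close>
  forces \<open>I = UNIV\<close>.
\<close>

definition radical :: "'a::comm_semiring_1 set \<Rightarrow> 'a set" where
  "radical I = {a. \<exists>n::nat. n > 0 \<and> a ^ n \<in> I}"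

definition nilradical :: "'a::comm_semiring_1 set" where
  "nilradical = radical {0}"

definition quasi_S_n_ideal :: "'a::comm_semiring_1 set \<Rightarrow> 'a set \<Rightarrow> bool" where
  "quasi_S_n_ideal S I \<longleftrightarrow>
     proper_ideal I \<and> I \<inter> S = {} \<and>
     (\<exists>s\<in>S. \<forall>a b. a * b \<in> I \<longrightarrow> s * a\<^sup>2 \<in> I \<or> s * b \<in> nilradical)"

definition strongly_quasi_S_primary :: "'a::comm_semiring_1 set \<Rightarrow> 'a set \<Rightarrow> bool" where
  "strongly_quasi_S_primary S I \<longleftrightarrow>
     proper_ideal I \<and> I \<inter> S = {} \<and>
     (\<exists>s\<in>S. \<forall>a b. a * b \<in> I \<longrightarrow> s * a\<^sup>2 \<in> I \<or> s * b \<in> radical I)"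

end

theory Submission
  imports Defs
begin

text \<open>
  Once \<open>\<surd>I\<close> equals the nilradical, the two defining conditions are literally the same, so the
  content lies in showing that a quasi \<open>S\<close>-\<open>n\<close>-ideal \<open>I\<close> has radical \<open>N(R)\<close>. If \<open>s\<close> is the fixed
  element and \<open>x \<in> I\<close>, apply the condition to the product \<open>1 * x \<in> I\<close>. The first alternative would
  put \<open>s\<close> into \<open>I \<inter> S\<close>, hence \<open>s * x\<close> is nilpotent; as \<open>s\<close> is regular it can be cancelled
  (\<open>nilradical_cancel_regular\<close>), so \<open>x\<close> is nilpotent. Thus \<open>I\<close> lies in the nilradical, and since a
  root of a nilpotent element is nilpotent, so does \<open>\<surd>I\<close>.
\<close>

lemma regular_cancel: "s \<in> Reg \<Longrightarrow> s * x = 0 \<Longrightarrow> x = 0"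
  by (auto simp: Reg_def zero_divisor_def)

lemma regular_power_cancel: "s \<in> Reg \<Longrightarrow> s ^ n * x = 0 \<Longrightarrow> x = 0"
  by (induction n) (auto simp: mult.assoc dest: regular_cancel)

text \<open>
  If \<open>(s * x) ^ n = s ^ n * x ^ n\<close> vanishes, the regular factors can be removed one at a time,
  leaving \<open>x ^ n = 0\<close>.
\<close>

lemma nilradical_cancel_regular:
  assumes "s \<in> Reg" and "s * x \<in> nilradical"
  shows "x \<in> nilradical"
  using assms
  by (auto simp: nilradical_def radical_def power_mult_distrib dest: regular_power_cancel)

lemma zero_in_semiring_ideal:
  assumes "semiring_ideal I"
  shows "0 \<in> I"
proof -
  from assms obtain a where "a \<in> I"
    by (auto simp: semiring_ideal_def)
  with assms have "0 * a \<in> I"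
    unfolding semiring_ideal_def by blast
  then show ?thesis by simp
qed

lemma nilradical_subset_radical: "semiring_ideal I \<Longrightarrow> nilradical \<subseteq> radical I"
  using zero_in_semiring_ideal[of I] by (auto simp: nilradical_def radical_def)

lemma radical_subset_nilradical:
  assumes "I \<subseteq> nilradical"
  shows "radical I \<subseteq> nilradical"
proof
  fix a assume "a \<in> radical I"
  then obtain m where m: "m > 0" "a ^ m \<in> nilradical"
    using assms by (auto simp: radical_def)
  then obtain n where n: "n > 0" "(a ^ m) ^ n = 0"
    by (auto simp: nilradical_def radical_def)
  then have "a ^ (m * n) = 0" and "m * n > 0"
    using m by (simp_all add: power_mult)
  then show "a \<in> nilradical"
    unfolding nilradical_def radical_def by blast
qed

lemma quasi_S_n_ideal_subset_nilradical:
  assumes "S \<subseteq> Reg" and "quasi_S_n_ideal S I"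
  shows "I \<subseteq> nilradical"
proof
  fix x assume "x \<in> I"
  from assms(2) obtain s where s: "s \<in> S" "s \<notin> I"
    and cond: "\<And>a b. a * b \<in> I \<Longrightarrow> s * a\<^sup>2 \<in> I \<or> s * b \<in> nilradical"
    unfolding quasi_S_n_ideal_def by blast
  from cond[of 1 x] \<open>x \<in> I\<close> s have "s * x \<in> nilradical"
    by simp
  with s assms(1) show "x \<in> nilradical"
    by (blast intro: nilradical_cancel_regular)
qed

theorem theorem2p10:
  fixes S I :: "'a::comm_semiring_1 set"
  assumes "mult_closed S"
    and "S \<subseteq> Reg"
    and "proper_ideal I"
    and "I \<inter> S = {}"
  shows "quasi_S_n_ideal S I \<longleftrightarrow>
    strongly_quasi_S_primary S I \<and> radical I = nilradical"
proof -
  have same: "quasi_S_n_ideal S I \<longleftrightarrow> strongly_quasi_S_primary S I"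
    if "radical I = nilradical"
    using that by (simp add: quasi_S_n_ideal_def strongly_quasi_S_primary_def)
  have "radical I = nilradical" if "quasi_S_n_ideal S I"
  proof
    show "radical I \<subseteq> nilradical"
      using assms(2) that
      by (intro radical_subset_nilradical quasi_S_n_ideal_subset_nilradical)
    show "nilradical \<subseteq> radical I"
      using assms(3) by (simp add: proper_ideal_def nilradical_subset_radical)
  qed
  with same show ?thesis by blast
qed

end
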